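(* Let $(\Omega,\Sigma,\mu)$ be a measure space and let $Y$ be a strictly convex Banach space over $\mathbb K\in\{\mathbb R,\mathbb C\}$. Let $u\in\mathrm{NA}_\pi(L_1(\mu)\widehat{\otimes}_\pi Y)$. Then there are a set $I\subseteq\mathbb N$, a family of pairwise non-colinear vectors $(y_i)_{i\in I}\subseteq S_Y$ and a family of non-zero functions $(f_i)_{i\in I}\subseteq L_1(\mu)$ such that $$u=\sum_{i\in I} f_i\otimes y_i\quad\text{and}\quad \|u\|=\sum_{i\in I}\|f_i\|.$$ Indeed, for each $i\in I$, $f_i=(y_i^*\circ u)\chi_{E_i}$, where $y_i^*\in S_{Y^*}$ is any functional with $y_i^*(y_i)=1$ and $E_i=\{\omega\in\Omega: u(\omega)\in\operatorname{span}\{y_i\}\}$ (a measurable set, modulo null sets). Furthermore, this representation is unique up to scalar multiplication: if $J\subseteq\mathbb N$, $(z_j)_{j\in J}\subseteq S_Y$ are pairwise non-colinear and $(g_j)_{j\in J}\subseteq L_1(\mu)$ are non-zero with $u=\sum_{j\in J}g_j\otimes z_j$ and $\|u\|=\sum_{j\in J}\|g_j\|$, then there are a bijection $\varphi:I\to J$ and scalars $\theta_i\in\mathbb K$ with $|\theta_i|=1$ such that $z_{\varphi(i)}=\theta_i y_i$ and $g_{\varphi(i)}=\theta_i^{-1}f_i$ for all $i\in I$.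
   Context: $X\widehat{\otimes}_\pi Y$ denotes the projective tensor product of Banach spaces. An element $u\in X\widehat{\otimes}_\pi Y$ attains its projective norm if there are $(x_i)\subseteq X$, $(y_i)\subseteq Y$ with $u=\sum_{i=1}^\infty x_i\otimes y_i$ and $\|u\|_\pi=\sum_{i=1}^\infty\|x_i\|\|y_i\|$; $\mathrm{NA}_\pi(X\widehat{\otimes}_\pi Y)$ is the set of such elements. $L_1(\mu)\widehat{\otimes}_\pi Y$ is isometrically identified with the space $L_1(\mu,Y)$ of Bochner integrable functions via $(f\otimes y)(\omega)=f(\omega)y$. $S_Y$ is the unit sphere of $Y$. $Y$ is strictly convex if $\|x+y\|<2$ for all distinct $x,y\in S_Y$. Two vectors are colinear if they are linearly dependent over $\mathbb K$. $I$ may be finite (or empty, if $u=0$). *)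

theory Defs
  imports "HOL-Analysis.Analysis"
begin

text \<open>
  The scalar field is \<open>\<real>\<close> or \<open>\<complex>\<close>, up to isometric isomorphism.
\<close>

class real_or_complex = real_normed_field + banach + second_countable_topology +
  assumes real_or_complex:
    "\<exists>h :: 'a \<Rightarrow> complex.
       (\<forall>a b. h (a + b) = h a + h b) \<and> (\<forall>a b. h (a * b) = h a * h b) \<and>
       (\<forall>r a. h (r *\<^sub>R a) = r *\<^sub>R h a) \<and> (\<forall>a. norm (h a) = norm a) \<and>
       (range h = \<real> \<or> range h = UNIV)"

instance real :: real_or_complex
proof
  show "\<exists>h :: real \<Rightarrow> complex.
       (\<forall>a b. h (a + b) = h a + h b) \<and> (\<forall>a b. h (a * b) = h a * h b) \<and>
       (\<forall>r a. h (r *\<^sub>R a) = r *\<^sub>R h a) \<and> (\<forall>a. norm (h a) = norm a) \<and>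
       (range h = \<real> \<or> range h = UNIV)"
    by (rule exI[of _ of_real]) (auto simp: Reals_def scaleR_conv_of_real)
qed

instance complex :: real_or_complex
proof
  show "\<exists>h :: complex \<Rightarrow> complex.
       (\<forall>a b. h (a + b) = h a + h b) \<and> (\<forall>a b. h (a * b) = h a * h b) \<and>
       (\<forall>r a. h (r *\<^sub>R a) = r *\<^sub>R h a) \<and> (\<forall>a. norm (h a) = norm a) \<and>
       (range h = \<real> \<or> range h = UNIV)"
    by (rule exI[of _ "\<lambda>x. x"]) auto
qed

text \<open>
  A Banach space over \<open>'k\<close>: the class \<^class>\<open>banach\<close> supplies the norm, completeness and the
  underlying real space, and \<open>scl\<close> is the multiplication by scalars of \<open>'k\<close>.
\<close>

locale banach_over = vector_space scl
  for scl :: "'k::real_or_complex \<Rightarrow> 'y::banach \<Rightarrow> 'y" +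
  assumes norm_scl: "norm (scl c y) = norm c * norm y"
    and scl_of_real: "scl (of_real r) y = r *\<^sub>R y"

lemma banach_over_scaleR: "banach_over ((*\<^sub>R) :: real \<Rightarrow> 'y::banach \<Rightarrow> 'y)"
  by unfold_locales (auto simp: algebra_simps)

lemma banach_over_mult: "banach_over ((*) :: 'k::real_or_complex \<Rightarrow> 'k \<Rightarrow> 'k)"
  by unfold_locales (auto simp: algebra_simps norm_mult scaleR_conv_of_real)

definition strictly_convex :: "'y::real_normed_vector itself \<Rightarrow> bool" where
  "strictly_convex _ \<longleftrightarrow>
     (\<forall>x y :: 'y. norm x = 1 \<longrightarrow> norm y = 1 \<longrightarrow> x \<noteq> y \<longrightarrow> norm (x + y) < 2)"

text \<open>
  Linear dependence of the family \<open>(x, y)\<close>. This is not \<open>dependent {x, y}\<close>, which fails to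
  see the dependence when \<open>x = y\<close>.
\<close>

definition colinear :: "('k::real_or_complex \<Rightarrow> 'y::banach \<Rightarrow> 'y) \<Rightarrow> 'y \<Rightarrow> 'y \<Rightarrow> bool" where
  "colinear scl x y \<longleftrightarrow> (\<exists>a b. (a \<noteq> 0 \<or> b \<noteq> 0) \<and> scl a x + scl b y = 0)"

definition dual_sphere :: "('k::real_or_complex \<Rightarrow> 'y::banach \<Rightarrow> 'y) \<Rightarrow> ('y \<Rightarrow> 'k) set" where
  "dual_sphere scl =
     {h. bounded_linear h \<and> (\<forall>c y. h (scl c y) = c * h y) \<and> onorm h = 1}"

text \<open>
  The library's \<^const>\<open>integrable\<close> requires a second countable codomain, whereas \<open>Y\<close> may be
  non-separable. As in the library, elements of \<open>L\<^sub>1(\<mu>, Y)\<close> are represented by functions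
  that are measurable everywhere (here: pointwise limits of simple functions), and equality
  in \<open>L\<^sub>1\<close> is equality almost everywhere.
\<close>

definition strongly_measurable :: "'a measure \<Rightarrow> ('a \<Rightarrow> 'y::real_normed_vector) \<Rightarrow> bool" where
  "strongly_measurable M u \<longleftrightarrow>
     (\<exists>s. (\<forall>n. simple_function M (s n)) \<and> (\<forall>w\<in>space M. (\<lambda>n. s n w) \<longlonglongrightarrow> u w))"

definition bochner_integrable :: "'a measure \<Rightarrow> ('a \<Rightarrow> 'y::banach) \<Rightarrow> bool" where
  "bochner_integrable M u \<longleftrightarrow> strongly_measurable M u \<and> integrable M (\<lambda>w. norm (u w))"

lemma bochner_integrable_iff_integrable:
  fixes u :: "'a \<Rightarrow> 'y::{banach, second_countable_topology}"
  shows "bochner_integrable M u \<longleftrightarrow> integrable M u"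
proof -
  have "strongly_measurable M u \<longleftrightarrow> u \<in> borel_measurable M"
  proof
    assume "strongly_measurable M u"
    then obtain s where s: "\<And>n. simple_function M (s n)"
      "\<And>w. w \<in> space M \<Longrightarrow> (\<lambda>n. s n w) \<longlonglongrightarrow> u w"
      unfolding strongly_measurable_def by blast
    show "u \<in> borel_measurable M"
      by (rule borel_measurable_LIMSEQ_metric[of s])
        (auto intro: borel_measurable_simple_function s)
  next
    assume "u \<in> borel_measurable M"
    then obtain s where "\<And>n. simple_function M (s n)"
      "\<And>w. w \<in> space M \<Longrightarrow> (\<lambda>n. s n w) \<longlonglongrightarrow> u w"
      using borel_measurable_implies_sequence_metric[of u M 0] by blast
    then show "strongly_measurable M u"
      unfolding strongly_measurable_def by blast
  qed
  then show ?thesis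
    unfolding bochner_integrable_def
    by (auto simp: integrable_norm_iff)
qed

definition L1_norm :: "'a measure \<Rightarrow> ('a \<Rightarrow> 'y::real_normed_vector) \<Rightarrow> real" where
  "L1_norm M u = (\<integral>w. norm (u w) \<partial>M)"

text \<open>
  The projective tensor product of \<open>L\<^sub>1(\<mu>)\<close> and \<open>Y\<close> is identified with \<open>L\<^sub>1(\<mu>, Y)\<close> through
  the elementary tensors below.
\<close>

definition tensor ::
  "('k::real_or_complex \<Rightarrow> 'y::banach \<Rightarrow> 'y) \<Rightarrow> ('a \<Rightarrow> 'k) \<Rightarrow> 'y \<Rightarrow> 'a \<Rightarrow> 'y" where
  "tensor scl f y = (\<lambda>w. scl (f w) y)"

text \<open>
  \<open>u = (\<Sum>i\<in>I. f i \<otimes> y i)\<close> as an unconditionally convergent sum in \<open>L\<^sub>1(\<mu>, Y)\<close>; it is used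
  only for families with finite \<open>\<Sum>i\<in>I. \<parallel>f i\<parallel> \<parallel>y i\<parallel>\<close>, where the order of summation is immaterial.
\<close>

definition has_tensor_sum ::
  "'a measure \<Rightarrow> ('k::real_or_complex \<Rightarrow> 'y::banach \<Rightarrow> 'y) \<Rightarrow> nat set \<Rightarrow>
   (nat \<Rightarrow> 'a \<Rightarrow> 'k) \<Rightarrow> (nat \<Rightarrow> 'y) \<Rightarrow> ('a \<Rightarrow> 'y) \<Rightarrow> bool" where
  "has_tensor_sum M scl I f y u \<longleftrightarrow>
     ((\<lambda>F. L1_norm M (\<lambda>w. u w - (\<Sum>i\<in>F. tensor scl (f i) (y i) w))) \<longlongrightarrow> 0)
       (finite_subsets_at_top I)"

text \<open>
  The projective norm of an element of the completed tensor product is the infimum of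
  \<open>\<Sum>i. \<parallel>x i\<parallel> \<parallel>y i\<parallel>\<close> over its representations as a series of elementary tensors. That it
  agrees with \<^const>\<open>L1_norm\<close> on \<open>L\<^sub>1(\<mu>, Y)\<close> is a theorem, not part of the definition.
\<close>

definition proj_norm ::
  "'a measure \<Rightarrow> ('k::real_or_complex \<Rightarrow> 'y::banach \<Rightarrow> 'y) \<Rightarrow> ('a \<Rightarrow> 'y) \<Rightarrow> real" where
  "proj_norm M scl u = Inf {t. \<exists>x y. (\<forall>i. integrable M (x i)) \<and>
     has_tensor_sum M scl UNIV x y u \<and>
     ((\<lambda>i. L1_norm M (x i) * norm (y i)) has_sum t) UNIV}"

definition NA_proj ::
  "'a measure \<Rightarrow> ('k::real_or_complex \<Rightarrow> 'y::banach \<Rightarrow> 'y) \<Rightarrow> ('a \<Rightarrow> 'y) set" where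
  "NA_proj M scl = {u. bochner_integrable M u \<and>
     (\<exists>x y. (\<forall>i. integrable M (x i)) \<and> has_tensor_sum M scl UNIV x y u \<and>
        ((\<lambda>i. L1_norm M (x i) * norm (y i)) has_sum proj_norm M scl u) UNIV)}"

definition noncolinear_rep ::
  "'a measure \<Rightarrow> ('k::real_or_complex \<Rightarrow> 'y::banach \<Rightarrow> 'y) \<Rightarrow> ('a \<Rightarrow> 'y) \<Rightarrow> nat set \<Rightarrow>
   (nat \<Rightarrow> 'a \<Rightarrow> 'k) \<Rightarrow> (nat \<Rightarrow> 'y) \<Rightarrow> bool" where
  "noncolinear_rep M scl u I f y \<longleftrightarrow>
     (\<forall>i\<in>I. norm (y i) = 1) \<and>
     (\<forall>i\<in>I. \<forall>j\<in>I. i \<noteq> j \<longrightarrow> \<not> colinear scl (y i) (y j)) \<and>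
     (\<forall>i\<in>I. integrable M (f i) \<and> \<not> (AE w in M. f i w = 0)) \<and>
     has_tensor_sum M scl I f y u \<and>
     ((\<lambda>i. L1_norm M (f i)) has_sum proj_norm M scl u) I"

end

theory Submission
  imports Defs
begin

text \<open>
  The projective norm on \<open>L\<^sub>1(\<mu>, Y)\<close> is the \<open>L\<^sub>1\<close>-norm, so if
  \<open>u = (\<Sum>i. x\<^sub>i \<otimes> y\<^sub>i)\<close> attains its projective norm, then for almost every \<open>\<omega>\<close>
  the triangle inequality \<open>\<parallel>u(\<omega>)\<parallel> \<le> (\<Sum>i. \<parallel>x\<^sub>i(\<omega>) y\<^sub>i\<parallel>)\<close> is an equality. By strict
  convexity every non-zero term \<open>x\<^sub>i(\<omega>) y\<^sub>i\<close> is then a positive multiple of \<open>u(\<omega>)\<close>: almost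
  everywhere on the support of \<open>u\<close>, the value \<open>u(\<omega>)\<close> lies on one of the countably many lines
  \<open>span {y\<^sub>i}\<close>. Two distinct lines meet only in \<open>0\<close>, so when the lines are distinct the series
  reduces pointwise to a single term, and the coefficient of \<open>y\<^sub>i\<close> must be the coordinate
  of \<open>u(\<omega>)\<close> along that line. This forces both existence and uniqueness.
\<close>

section \<open>Norm equality in strictly convex spaces\<close>

lemma norm_add_eq_imp_scaleR_eq:
  fixes a b :: "'y::real_normed_vector"
  assumes "strictly_convex TYPE('y)" and eq: "norm (a + b) = norm a + norm b"
  shows "norm b *\<^sub>R a = norm a *\<^sub>R b"
proof -
  have le: "norm b *\<^sub>R a = norm a *\<^sub>R b"
    if eq: "norm (a + b) = norm a + norm b" and "norm a \<le> norm b" for a b :: 'y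
  proof (cases "a = 0")
    case False
    then have pos: "norm a > 0" "norm b > 0" using that(2) by auto
    define a' b' where "a' = a /\<^sub>R norm a" and "b' = b /\<^sub>R norm b"
    have 1: "norm a' = 1" "norm b' = 1" using pos by (auto simp: a'_def b'_def)
    have "norm a *\<^sub>R a' = a" "norm b *\<^sub>R b' = b" using pos by (auto simp: a'_def b'_def)
    then have "a + b = norm a *\<^sub>R (a' + b') + (norm b - norm a) *\<^sub>R b'"
      by (simp add: scaleR_add_right scaleR_diff_left)
    then have "norm (a + b) \<le> norm (norm a *\<^sub>R (a' + b')) + norm ((norm b - norm a) *\<^sub>R b')"
      by (simp only: norm_triangle_ineq)
    also have "\<dots> = norm a * norm (a' + b') + (norm b - norm a)"
      using that(2) 1 by simp
    finally have "norm (a + b) \<le> norm a * norm (a' + b') + (norm b - norm a)" .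
    then have "2 * norm a \<le> norm a * norm (a' + b')" using that(1) by simp
    then have "\<not> norm (a' + b') < 2" using pos(1) by (simp add: mult.commute)
    then have "a' = b'" using assms(1) 1 unfolding strictly_convex_def by blast
    then have "norm b *\<^sub>R norm a *\<^sub>R a' = norm a *\<^sub>R norm b *\<^sub>R b'" by simp
    then show ?thesis using \<open>norm a *\<^sub>R a' = a\<close> \<open>norm b *\<^sub>R b' = b\<close> by simp
  qed simp
  show ?thesis
  proof (cases "norm a \<le> norm b")
    case True with le eq show ?thesis by blast
  next
    case False
    then have "norm a *\<^sub>R b = norm b *\<^sub>R a"
      using le[of b a] eq by (simp add: add.commute)
    then show ?thesis by simp
  qed
qed

lemma has_sum_norm_eq_imp_scaleR_eq:
  fixes v :: "'i \<Rightarrow> 'y::banach"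
  assumes "strictly_convex TYPE('y)"
    and v: "(v has_sum s) I" and n: "((\<lambda>i. norm (v i)) has_sum norm s) I" and "i \<in> I"
  shows "norm s *\<^sub>R v i = norm (v i) *\<^sub>R s"
proof -
  define r where "r = s - v i"
  have r: "(v has_sum r) (I - {i})"
    using has_sum_Diff[OF v, of "{i}" "v i"] \<open>i \<in> I\<close> by (simp add: r_def has_sum_finiteI)
  have m: "((\<lambda>i. norm (v i)) has_sum (norm s - norm (v i))) (I - {i})"
    using has_sum_Diff[OF n, of "{i}" "norm (v i)"] \<open>i \<in> I\<close> by (simp add: has_sum_finiteI)
  have "norm r \<le> norm s - norm (v i)"
    using norm_has_sum_bound[OF m r] .
  moreover have s: "s = v i + r" by (simp add: r_def)
  ultimately have e: "norm (v i + r) = norm (v i) + norm r"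
    using norm_triangle_ineq[of "v i" r] by simp
  have "norm r *\<^sub>R v i = norm (v i) *\<^sub>R r"
    by (rule norm_add_eq_imp_scaleR_eq[OF assms(1) e])
  then show ?thesis unfolding s e by (simp add: algebra_simps)
qed

lemma has_sum_norm_eq_imp_ray:
  fixes v :: "'i \<Rightarrow> 'y::banach"
  assumes "strictly_convex TYPE('y)"
    and v: "(v has_sum s) I" and n: "((\<lambda>i. norm (v i)) has_sum norm s) I"
    and "i \<in> I" and "v i \<noteq> 0"
  shows "\<exists>r>0. s = r *\<^sub>R v i"
proof -
  have "norm (v i) \<le> norm s"
    using finite_sum_le_has_sum[OF n, of "{i}"] \<open>i \<in> I\<close> by simp
  then have s: "norm s > 0" using \<open>v i \<noteq> 0\<close> by (smt (verit) zero_less_norm_iff)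
  have eq: "norm (v i) *\<^sub>R s = norm s *\<^sub>R v i"
    using has_sum_norm_eq_imp_scaleR_eq[OF assms(1) v n \<open>i \<in> I\<close>] by simp
  have "s = inverse (norm (v i)) *\<^sub>R (norm (v i) *\<^sub>R s)"
    using \<open>v i \<noteq> 0\<close> by simp
  also have "\<dots> = (norm s / norm (v i)) *\<^sub>R v i"
    unfolding eq by (simp add: divide_inverse_commute)
  finally show ?thesis
    using s \<open>v i \<noteq> 0\<close> by (intro exI[of _ "norm s / norm (v i)"]) simp
qed

section \<open>Integration of series\<close>

lemma integrable_has_sum:
  fixes p :: "nat \<Rightarrow> 'a \<Rightarrow> real"
  assumes p: "\<And>i. i \<in> I \<Longrightarrow> integrable M (p i)"
    and nonneg: "\<And>i w. i \<in> I \<Longrightarrow> 0 \<le> p i w"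
    and sum: "((\<lambda>i. \<integral>w. p i w \<partial>M) has_sum t) I"
  shows "\<exists>P. integrable M P \<and> integral\<^sup>L M P = t \<and> (AE w in M. ((\<lambda>i. p i w) has_sum P w) I)"
proof -
  define q where "q i w = (if i \<in> I then p i w else 0)" for i w
  have q[measurable]: "integrable M (q i)" for i
    using p[of i] by (cases "i \<in> I") (simp_all add: q_def[abs_def])
  have q0: "0 \<le> q i w" for i w
    using nonneg[of i w] by (simp add: q_def)
  have "((\<lambda>i. \<integral>w. q i w \<partial>M) has_sum t) UNIV \<longleftrightarrow> ((\<lambda>i. \<integral>w. p i w \<partial>M) has_sum t) I"
    by (rule has_sum_cong_neutral) (auto simp: q_def)
  with sum have sums: "(\<lambda>i. \<integral>w. q i w \<partial>M) sums t"
    by (simp add: has_sum_imp_sums)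
  have "(\<integral>\<^sup>+w. (\<Sum>i. ennreal (q i w)) \<partial>M) = (\<Sum>i. \<integral>\<^sup>+w. q i w \<partial>M)"
    using q by (intro nn_integral_suminf) auto
  also have "\<dots> = (\<Sum>i. ennreal (\<integral>w. q i w \<partial>M))"
    using q q0 by (simp add: nn_integral_eq_integral)
  also have "\<dots> = ennreal t"
    using sums q0 by (intro suminf_ennreal_eq) (auto intro: Bochner_Integration.integral_nonneg)
  finally have "AE w in M. (\<Sum>i. ennreal (q i w)) \<noteq> \<infinity>"
    using q by (intro nn_integral_PInf_AE) auto
  then have ae: "AE w in M. summable (\<lambda>i. norm (q i w))"
    by eventually_elim (use q0 in \<open>auto intro: summable_suminf_not_top\<close>)
  define P where "P w = (\<Sum>i. q i w)" for w
  have n: "summable (\<lambda>i. \<integral>w. norm (q i w) \<partial>M)"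
    using sums q0 by (simp add: sums_iff)
  have "integrable M P" unfolding P_def
    by (rule integrable_suminf[OF q ae n])
  moreover have "integral\<^sup>L M P = t" unfolding P_def
    using integral_suminf[OF q ae n] sums by (simp add: sums_iff)
  moreover have "AE w in M. ((\<lambda>i. p i w) has_sum P w) I"
    using ae
  proof eventually_elim
    case (elim w)
    have "((\<lambda>i. q i w) has_sum P w) UNIV"
      using elim q0 unfolding P_def
      by (intro sums_nonneg_imp_has_sum summable_sums) auto
    moreover have "((\<lambda>i. q i w) has_sum P w) UNIV \<longleftrightarrow> ((\<lambda>i. p i w) has_sum P w) I"
      by (rule has_sum_cong_neutral) (auto simp: q_def)
    ultimately show ?case by simp
  qed
  ultimately show ?thesis by blast
qed

lemma has_sum_integral:
  fixes p :: "nat \<Rightarrow> 'a \<Rightarrow> real"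
  assumes p: "\<And>i. i \<in> I \<Longrightarrow> integrable M (p i)"
    and nonneg: "\<And>i w. i \<in> I \<Longrightarrow> 0 \<le> p i w"
    and P: "integrable M P" and ae: "AE w in M. ((\<lambda>i. p i w) has_sum P w) I"
  shows "((\<lambda>i. \<integral>w. p i w \<partial>M) has_sum (\<integral>w. P w \<partial>M)) I"
proof -
  have bound: "(\<Sum>i\<in>F. \<integral>w. p i w \<partial>M) \<le> (\<integral>w. P w \<partial>M)" if F: "finite F" "F \<subseteq> I" for F
  proof -
    have p': "integrable M (p i)" if "i \<in> F" for i using p F that by blast
    have "(\<Sum>i\<in>F. \<integral>w. p i w \<partial>M) = (\<integral>w. (\<Sum>i\<in>F. p i w) \<partial>M)"
      using p' by simp
    also have "\<dots> \<le> (\<integral>w. P w \<partial>M)"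
    proof (rule integral_mono_AE)
      show "AE w in M. (\<Sum>i\<in>F. p i w) \<le> P w"
        using ae by eventually_elim (use F nonneg in \<open>auto intro: finite_sum_le_has_sum\<close>)
    qed (use p' P in simp_all)
    finally show ?thesis .
  qed
  have "(\<lambda>i. \<integral>w. p i w \<partial>M) summable_on I"
    using bound nonneg
    by (intro nonneg_bdd_above_summable_on bdd_aboveI[of _ "\<integral>w. P w \<partial>M"])
      (auto intro: Bochner_Integration.integral_nonneg)
  then obtain t where t: "((\<lambda>i. \<integral>w. p i w \<partial>M) has_sum t) I"
    by (auto simp: summable_on_def)
  obtain Q where Q: "integrable M Q" "integral\<^sup>L M Q = t" "AE w in M. ((\<lambda>i. p i w) has_sum Q w) I"
    using integrable_has_sum[of I M p, OF p nonneg t] by blast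
  have "AE w in M. Q w = P w"
    using Q(3) ae by eventually_elim (rule has_sum_unique)
  then have "integral\<^sup>L M Q = integral\<^sup>L M P"
    using Q(1) P by (intro integral_cong_AE) auto
  with t Q(2) show ?thesis by simp
qed

section \<open>Strong measurability and Bochner integrability\<close>

lemma strongly_measurable_borel:
  "strongly_measurable M u \<Longrightarrow> u \<in> borel_measurable M"
  unfolding strongly_measurable_def
  by (metis borel_measurable_LIMSEQ_metric borel_measurable_simple_function)

lemma strongly_measurable_compose:
  assumes "strongly_measurable M u" and "continuous_on UNIV h"
  shows "strongly_measurable M (\<lambda>w. h (u w))"
proof -
  obtain s where s: "\<And>n. simple_function M (s n)" "\<And>w. w \<in> space M \<Longrightarrow> (\<lambda>n. s n w) \<longlonglongrightarrow> u w"
    using assms(1) unfolding strongly_measurable_def by blast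
  have "\<forall>n. simple_function M (\<lambda>w. h (s n w))"
    using simple_function_compose1[OF s(1), of h] by simp
  moreover have "(\<lambda>n. h (s n w)) \<longlonglongrightarrow> h (u w)" if "w \<in> space M" for w
    using continuous_on_tendsto_compose[OF assms(2) s(2)[OF that]] by simp
  ultimately show ?thesis unfolding strongly_measurable_def
    by (intro exI[of _ "\<lambda>n w. h (s n w)"]) blast
qed

lemma borel_measurable_norm_strongly:
  assumes "strongly_measurable M u"
  shows "(\<lambda>w. norm (u w)) \<in> borel_measurable M"
  using strongly_measurable_borel[OF strongly_measurable_compose[OF assms, of norm]]
  by (simp add: continuous_on_norm_id)

lemma strongly_measurable_add:
  assumes "strongly_measurable M u" and "strongly_measurable M v"
  shows "strongly_measurable M (\<lambda>w. u w + v w)"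
proof -
  obtain s where s: "\<And>n. simple_function M (s n)" "\<And>w. w \<in> space M \<Longrightarrow> (\<lambda>n. s n w) \<longlonglongrightarrow> u w"
    using assms(1) unfolding strongly_measurable_def by blast
  obtain r where r: "\<And>n. simple_function M (r n)" "\<And>w. w \<in> space M \<Longrightarrow> (\<lambda>n. r n w) \<longlonglongrightarrow> v w"
    using assms(2) unfolding strongly_measurable_def by blast
  have "\<forall>n. simple_function M (\<lambda>w. s n w + r n w)"
    using s(1) r(1) by (simp add: simple_function_add)
  moreover have "\<forall>w\<in>space M. (\<lambda>n. s n w + r n w) \<longlonglongrightarrow> u w + v w"
    using s(2) r(2) by (simp add: tendsto_add)
  ultimately show ?thesis unfolding strongly_measurable_def 
    by (intro exI[of _ "\<lambda>n w. s n w + r n w"]) blast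
qed

lemma strongly_measurable_const: "strongly_measurable M (\<lambda>w. c)"
  unfolding strongly_measurable_def by (intro exI[of _ "\<lambda>n w. c"]) simp

lemma strongly_measurable_diff:
  assumes "strongly_measurable M u" and "strongly_measurable M v"
  shows "strongly_measurable M (\<lambda>w. u w - v w)"
  using strongly_measurable_add[OF assms(1) strongly_measurable_compose[OF assms(2)
      continuous_on_minus[OF continuous_on_id]]] by simp

lemma borel_measurable_imp_strongly_measurable:
  fixes f :: "'a \<Rightarrow> 'k::{real_normed_vector, second_countable_topology}"
  assumes "f \<in> borel_measurable M"
  shows "strongly_measurable M f"
  unfolding strongly_measurable_def
  using borel_measurable_implies_sequence_metric[OF assms, of 0] by blast

context banach_over
begin

lemma bounded_linear_scl_left: "bounded_linear (\<lambda>c. scl c y)"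
proof (rule bounded_linear_intro)
  show "scl (r *\<^sub>R c) y = r *\<^sub>R scl c y" for r c
    by (simp add: scaleR_conv_of_real scl_of_real flip: scale_scale)
qed (auto simp: scale_left_distrib norm_scl)

lemma strongly_measurable_tensor:
  assumes "f \<in> borel_measurable M"
  shows "strongly_measurable M (tensor scl f y)"
  unfolding tensor_def
  by (rule strongly_measurable_compose[OF borel_measurable_imp_strongly_measurable[OF assms]])
    (rule linear_continuous_on[OF bounded_linear_scl_left])

lemma norm_tensor: "norm (tensor scl f y w) = norm (f w) * norm y"
  by (simp add: tensor_def norm_scl)

lemma bochner_integrable_tensor:
  assumes "integrable M f"
  shows "bochner_integrable M (tensor scl f y)"
  unfolding bochner_integrable_def
  using assms by (simp add: norm_tensor strongly_measurable_tensor)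

end

lemma bochner_integrable_add:
  assumes "bochner_integrable M u" and "bochner_integrable M v"
  shows "bochner_integrable M (\<lambda>w. u w + v w)"
proof -
  have m: "strongly_measurable M (\<lambda>w. u w + v w)"
    using assms by (simp add: bochner_integrable_def strongly_measurable_add)
  have "integrable M (\<lambda>w. norm (u w + v w))"
  proof (rule Bochner_Integration.integrable_bound)
    show "integrable M (\<lambda>w. norm (u w) + norm (v w))"
      using assms by (auto simp: bochner_integrable_def)
    show "(\<lambda>w. norm (u w + v w)) \<in> borel_measurable M"
      using m by (rule borel_measurable_norm_strongly)
  qed (auto intro: norm_triangle_ineq)
  with m show ?thesis by (simp add: bochner_integrable_def)
qed

lemma bochner_integrable_diff:
  assumes "bochner_integrable M u" and "bochner_integrable M v"
  shows "bochner_integrable M (\<lambda>w. u w - v w)"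
proof -
  have "bochner_integrable M (\<lambda>w. - v w)"
    using assms(2) strongly_measurable_diff[OF strongly_measurable_const[of M 0], of v]
    by (simp add: bochner_integrable_def)
  from bochner_integrable_add[OF assms(1) this] show ?thesis by simp
qed

lemma bochner_integrable_sum:
  assumes "finite F" and "\<And>i. i \<in> F \<Longrightarrow> bochner_integrable M (u i)"
  shows "bochner_integrable M (\<lambda>w. \<Sum>i\<in>F. u i w)"
  using assms
proof (induction F)
  case empty
  then show ?case by (simp add: bochner_integrable_def strongly_measurable_const)
next
  case (insert i F)
  have "bochner_integrable M (\<lambda>w. u i w + (\<Sum>i\<in>F. u i w))"
    by (rule bochner_integrable_add) (use insert in simp_all)
  with insert show ?case by simp
qed

section \<open>Series of elementary tensors\<close>

context banach_over
begin

lemma AE_has_sum_norm_tensor: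
  fixes I :: "nat set"
  assumes "\<forall>i\<in>I. integrable M (f i)"
    and "((\<lambda>i. L1_norm M (f i) * norm (y i)) has_sum t) I"
  shows "\<exists>P. integrable M P \<and> integral\<^sup>L M P = t \<and>
    (AE w in M. ((\<lambda>i. norm (tensor scl (f i) (y i) w)) has_sum P w) I)"
  using assms
  by (intro integrable_has_sum[where p = "\<lambda>i w. norm (tensor scl (f i) (y i) w)"])
    (simp_all add: norm_tensor L1_norm_def)

lemma bochner_integrable_diff_sum_tensor:
  assumes "bochner_integrable M u" and "finite F" and "\<And>i. i \<in> F \<Longrightarrow> integrable M (f i)"
  shows "bochner_integrable M (\<lambda>w. u w - (\<Sum>i\<in>F. tensor scl (f i) (y i) w))"
  using assms
  by (simp add: bochner_integrable_diff bochner_integrable_sum bochner_integrable_tensor)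

lemma has_tensor_sumI:
  assumes u: "bochner_integrable M u"
    and f: "\<forall>i\<in>I. integrable M (f i)"
    and t: "((\<lambda>i. L1_norm M (f i) * norm (y i)) has_sum t) I"
    and ae: "AE w in M. ((\<lambda>i. tensor scl (f i) (y i) w) has_sum u w) I"
  shows "has_tensor_sum M scl I f y u"
proof -
  let ?a = "\<lambda>i. L1_norm M (f i) * norm (y i)"
  let ?D = "\<lambda>F. L1_norm M (\<lambda>w. u w - (\<Sum>i\<in>F. tensor scl (f i) (y i) w))"
  have bound: "?D F \<le> t - sum ?a F" if F: "finite F" "F \<subseteq> I" for F
  proof -
    have "(?a has_sum (t - sum ?a F)) (I - F)"
      using F t by (intro has_sum_Diff) (auto intro: has_sum_finiteI)
    then obtain P where P: "integrable M P" "integral\<^sup>L M P = t - sum ?a F"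
      "AE w in M. ((\<lambda>i. norm (tensor scl (f i) (y i) w)) has_sum P w) (I - F)"
      using AE_has_sum_norm_tensor[of "I - F" M f y "t - sum ?a F"] f by blast
    have "?D F \<le> integral\<^sup>L M P"
      unfolding L1_norm_def
    proof (rule integral_mono_AE)
      show "integrable M (\<lambda>w. norm (u w - (\<Sum>i\<in>F. tensor scl (f i) (y i) w)))"
        using bochner_integrable_diff_sum_tensor[OF u F(1), of f y] f F(2)
        by (auto simp: bochner_integrable_def)
      show "AE w in M. norm (u w - (\<Sum>i\<in>F. tensor scl (f i) (y i) w)) \<le> P w"
        using ae P(3)
      proof eventually_elim
        case (elim w)
        have "((\<lambda>i. tensor scl (f i) (y i) w) has_sum
            (u w - (\<Sum>i\<in>F. tensor scl (f i) (y i) w))) (I - F)"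
          using F elim(1) by (intro has_sum_Diff) (auto intro: has_sum_finiteI)
        with elim(2) show ?case by (rule norm_has_sum_bound)
      qed
    qed (rule P(1))
    then show ?thesis by (simp add: P(2))
  qed
  have "((\<lambda>F. t - sum ?a F) \<longlongrightarrow> t - t) (finite_subsets_at_top I)"
    using t unfolding has_sum_def by (intro tendsto_diff tendsto_const)
  then have lim: "((\<lambda>F. t - sum ?a F) \<longlongrightarrow> 0) (finite_subsets_at_top I)" by simp
  show ?thesis
    unfolding has_tensor_sum_def
  proof (rule tendsto_sandwich[OF _ _ tendsto_const lim])
    show "\<forall>\<^sub>F F in finite_subsets_at_top I. 0 \<le> ?D F"
      by (simp add: L1_norm_def)
    show "\<forall>\<^sub>F F in finite_subsets_at_top I. ?D F \<le> t - sum ?a F"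
      using bound by (rule eventually_finite_subsets_at_top_weakI)
  qed
qed

lemma AE_has_sum_if_has_tensor_sum:
  assumes u: "bochner_integrable M u"
    and f: "\<forall>i\<in>I. integrable M (f i)"
    and t: "((\<lambda>i. L1_norm M (f i) * norm (y i)) has_sum t) I"
    and tens: "has_tensor_sum M scl I f y u"
  shows "AE w in M. ((\<lambda>i. tensor scl (f i) (y i) w) has_sum u w) I"
proof -
  define G where "G n = I \<inter> {..<n}" for n :: nat
  have G: "filterlim G (finite_subsets_at_top I) sequentially"
    unfolding filterlim_finite_subsets_at_top
  proof safe
    fix X assume X: "finite X" "X \<subseteq> I"
    then obtain n where "X \<subseteq> {..<n}" by (auto simp: finite_nat_set_iff_bounded)
    then have "\<forall>m\<ge>n. finite (G m) \<and> X \<subseteq> G m \<and> G m \<subseteq> I"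
      using X by (auto simp: G_def)
    then show "\<forall>\<^sub>F m in sequentially. finite (G m) \<and> X \<subseteq> G m \<and> G m \<subseteq> I"
      unfolding eventually_sequentially by blast
  qed
  define D where "D n w = norm (u w - (\<Sum>i\<in>G n. tensor scl (f i) (y i) w))" for n w
  have "integrable M (D n)" for n
    using bochner_integrable_diff_sum_tensor[OF u, of "G n" f y] f
    by (auto simp: bochner_integrable_def G_def D_def[abs_def])
  moreover have "(\<lambda>n. \<integral>w. norm (D n w) \<partial>M) \<longlonglongrightarrow> 0"
    using filterlim_compose[OF tens[unfolded has_tensor_sum_def] G]
    by (simp add: L1_norm_def D_def)
  ultimately obtain r :: "nat \<Rightarrow> nat"
    where r: "strict_mono r" "AE w in M. (\<lambda>n. D (r n) w) \<longlonglongrightarrow> 0"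
    using tendsto_L1_AE_subseq[of M D] by blast
  obtain P where P: "AE w in M. ((\<lambda>i. norm (tensor scl (f i) (y i) w)) has_sum P w) I"
    using AE_has_sum_norm_tensor[OF f t] by blast
  show ?thesis
    using r(2) P
  proof eventually_elim
    case (elim w)
    have "(\<lambda>i. tensor scl (f i) (y i) w) summable_on I"
      by (rule abs_summable_summable[OF has_sum_imp_summable[OF elim(2)]])
    then obtain S where S: "((\<lambda>i. tensor scl (f i) (y i) w) has_sum S) I"
      by (auto simp: summable_on_def)
    have "(\<lambda>n. \<Sum>i\<in>G (r n). tensor scl (f i) (y i) w) \<longlonglongrightarrow> S"
      using S unfolding has_sum_def
      by (rule filterlim_compose[OF _ filterlim_compose[OF G filterlim_subseq[OF r(1)]]])
    moreover have "(\<lambda>n. u w - (\<Sum>i\<in>G (r n). tensor scl (f i) (y i) w)) \<longlonglongrightarrow> 0"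
      using elim(1) unfolding D_def by (simp add: tendsto_norm_zero_iff)
    ultimately have "(\<lambda>n. (\<Sum>i\<in>G (r n). tensor scl (f i) (y i) w) +
        (u w - (\<Sum>i\<in>G (r n). tensor scl (f i) (y i) w))) \<longlonglongrightarrow> S + 0"
      by (rule tendsto_add)
    then have "u w = S" by (simp add: LIMSEQ_const_iff)
    with S show ?case by simp
  qed
qed

lemma L1_norm_le_tensor_sum:
  assumes u: "bochner_integrable M u"
    and f: "\<forall>i\<in>I. integrable M (f i)"
    and t: "((\<lambda>i. L1_norm M (f i) * norm (y i)) has_sum t) I"
    and tens: "has_tensor_sum M scl I f y u"
  shows "L1_norm M u \<le> t"
    and "L1_norm M u = t \<Longrightarrow>
      AE w in M. ((\<lambda>i. norm (tensor scl (f i) (y i) w)) has_sum norm (u w)) I"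
proof -
  obtain P where P: "integrable M P" "integral\<^sup>L M P = t"
    "AE w in M. ((\<lambda>i. norm (tensor scl (f i) (y i) w)) has_sum P w) I"
    using AE_has_sum_norm_tensor[OF f t] by blast
  have "AE w in M. ((\<lambda>i. tensor scl (f i) (y i) w) has_sum u w) I"
    by (rule AE_has_sum_if_has_tensor_sum[OF u f t tens])
  with P(3) have le: "AE w in M. norm (u w) \<le> P w"
    by eventually_elim (rule norm_has_sum_bound)
  have int: "integrable M (\<lambda>w. norm (u w))"
    using u by (simp add: bochner_integrable_def)
  show "L1_norm M u \<le> t"
    unfolding L1_norm_def P(2)[symmetric] by (rule integral_mono_AE[OF int P(1) le])
  assume "L1_norm M u = t"
  then have "(\<integral>w. P w - norm (u w) \<partial>M) = 0"
    using int P by (simp add: L1_norm_def)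
  then have "AE w in M. P w - norm (u w) = 0"
    using integral_nonneg_eq_0_iff_AE[of M "\<lambda>w. P w - norm (u w)"] int P(1) le by simp
  with P(3) show "AE w in M. ((\<lambda>i. norm (tensor scl (f i) (y i) w)) has_sum norm (u w)) I"
    by eventually_elim simp
qed

end

section \<open>The projective norm is the \<open>L\<^sub>1\<close>-norm\<close>

lemma countably_valued_approximation:
  fixes u :: "'a \<Rightarrow> 'y::banach"
  assumes u: "bochner_integrable M u" and \<epsilon>: "0 < \<epsilon>" "\<epsilon> < 1"
  shows "\<exists>A d u'. (\<forall>k::nat. integrable M (indicator (A k) :: 'a \<Rightarrow> real)) \<and>
    bochner_integrable M u' \<and>
    (\<forall>w\<in>space M. norm (u' w) \<le> \<epsilon> * norm (u w) \<and>
      ((\<lambda>k. indicator (A k) w *\<^sub>R d k) has_sum (u w - u' w)) UNIV \<and>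
      ((\<lambda>k. norm ((indicator (A k) w :: real) *\<^sub>R d k)) has_sum norm (u w - u' w)) UNIV)"
proof -
  have um: "strongly_measurable M u" and ui: "integrable M (\<lambda>w. norm (u w))"
    using u by (auto simp: bochner_integrable_def)
  obtain s where s: "\<And>n. simple_function M (s n)"
    and lim: "\<And>w. w \<in> space M \<Longrightarrow> (\<lambda>n. s n w) \<longlonglongrightarrow> u w"
    using um unfolding strongly_measurable_def by blast
  define D where "D = insert 0 (\<Union>n. s n ` space M)"
  define d where "d = from_nat_into D"
  have "countable D"
    unfolding D_def using simple_functionD(1)[OF s] by (auto intro: countable_finite)
  then have d: "range d = D"
    unfolding d_def by (intro range_from_nat_into) (auto simp: D_def)
  define B where "B k = {w \<in> space M. u w \<noteq> 0 \<and> norm (u w - d k) \<le> \<epsilon> * norm (u w)}" for k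
  define A where "A = disjointed B"
  have [measurable]: "(\<lambda>w. norm (u w - c)) \<in> borel_measurable M" for c
    by (intro borel_measurable_norm_strongly strongly_measurable_diff um strongly_measurable_const)
  have [measurable]: "(\<lambda>w. norm (u w)) \<in> borel_measurable M"
    using um by (rule borel_measurable_norm_strongly)
  have B_sets: "B k \<in> sets M" for k
  proof -
    have "{w \<in> space M. norm (u w) \<noteq> 0 \<and> norm (u w - d k) \<le> \<epsilon> * norm (u w)} \<in> sets M"
      by measurable
    also have "{w \<in> space M. norm (u w) \<noteq> 0 \<and> norm (u w - d k) \<le> \<epsilon> * norm (u w)} = B k"
      by (simp add: B_def)
    finally show ?thesis .
  qed
  then have A[measurable]: "A k \<in> sets M" for k
    unfolding A_def disjointed_def by auto
  have A_B: "A k \<subseteq> B k" for k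
    unfolding A_def by (rule disjointed_subset)
  have A_disj: "j = k" if "w \<in> A j" "w \<in> A k" for w j k
    using disjoint_family_disjointed[of B] that unfolding A_def disjoint_family_on_def by blast
  have cover: "\<exists>k. w \<in> A k" if w: "w \<in> space M" "u w \<noteq> 0" for w
  proof -
    have "\<forall>\<^sub>F n in sequentially. dist (s n w) (u w) < \<epsilon> * norm (u w)"
      using lim[OF w(1)] w(2) \<epsilon>(1) by (intro tendstoD) auto
    then obtain n where "dist (s n w) (u w) < \<epsilon> * norm (u w)"
      by (auto simp: eventually_sequentially)
    moreover have "s n w \<in> range d" unfolding d D_def using w(1) by blast
    ultimately obtain k where "dist (d k) (u w) < \<epsilon> * norm (u w)" by auto
    then have "w \<in> B k" using w by (auto simp: B_def dist_norm norm_minus_commute)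
    then show ?thesis
      using UN_disjointed_eq[of B] unfolding A_def by blast
  qed
  define v where "v w = (\<Sum>k. indicator (A k) w *\<^sub>R d k)" for w
  have v_eq: "v w = d k" if "w \<in> A k" for w k
  proof -
    have "(\<lambda>j. indicator (A j) w *\<^sub>R d j) sums (\<Sum>j\<in>{k}. indicator (A j) w *\<^sub>R d j)"
      using A_disj[OF that] by (intro sums_finite) (auto simp: indicator_def)
    with that show ?thesis by (simp add: v_def sums_iff)
  qed
  have v_0: "v w = 0" if "\<And>k. w \<notin> A k" for w
    using that by (simp add: v_def)
  have has_sum_v: "((\<lambda>k. indicator (A k) w *\<^sub>R d k) has_sum v w) UNIV \<and>
      ((\<lambda>k. norm ((indicator (A k) w :: real) *\<^sub>R d k)) has_sum norm (v w)) UNIV" for w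
  proof (cases "\<exists>k. w \<in> A k")
    case True
    then obtain k where k: "w \<in> A k" by blast
    have "indicator (A j) w = (0 :: real)" if "j \<noteq> k" for j
      using A_disj[OF k, of j] that by (auto simp: indicator_def)
    then show ?thesis
      by (intro conjI; intro has_sum_finite_neutralI[of "{k}"]) (simp_all add: v_eq[OF k] k)
  next
    case False
    then show ?thesis by (simp add: v_0)
  qed
  have approx: "norm (u w - v w) \<le> \<epsilon> * norm (u w)" if "w \<in> space M" for w
  proof (cases "\<exists>k. w \<in> A k")
    case True
    then obtain k where k: "w \<in> A k" by blast
    then show ?thesis using A_B by (auto simp: v_eq[OF k] B_def)
  next
    case False
    then have "u w = 0" using cover that by blast
    with False show ?thesis by (simp add: v_0)
  qed
  have "strongly_measurable M v"
    unfolding strongly_measurable_def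
  proof (intro exI[of _ "\<lambda>n w. \<Sum>k<n. indicator (A k) w *\<^sub>R d k"] conjI allI ballI)
    show "simple_function M (\<lambda>w. \<Sum>k<n. indicator (A k) w *\<^sub>R d k)" for n
      by (intro simple_function_sum simple_function_compose1[where g = "\<lambda>r. r *\<^sub>R d _"]
          simple_function_indicator A)
    show "(\<lambda>n. \<Sum>k<n. indicator (A k) w *\<^sub>R d k) \<longlonglongrightarrow> v w" for w
      using has_sum_imp_sums[OF conjunct1[OF has_sum_v[of w]]] by (simp add: sums_def)
  qed
  then have u'm: "strongly_measurable M (\<lambda>w. u w - v w)"
    using um by (simp add: strongly_measurable_diff)
  have "integrable M (\<lambda>w. norm (u w - v w))"
  proof (rule Bochner_Integration.integrable_bound)
    show "integrable M (\<lambda>w. \<epsilon> * norm (u w))" using ui by simp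
    show "(\<lambda>w. norm (u w - v w)) \<in> borel_measurable M"
      using u'm by (rule borel_measurable_norm_strongly)
    show "AE w in M. norm (norm (u w - v w)) \<le> norm (\<epsilon> * norm (u w))"
      using approx \<epsilon>(1) by (intro AE_I2) simp
  qed
  with u'm have u': "bochner_integrable M (\<lambda>w. u w - v w)"
    by (simp add: bochner_integrable_def)
  have "integrable M (indicator (A k) :: 'a \<Rightarrow> real)" for k
  proof (cases "d k = 0")
    case True
    have "\<not> norm (u w) \<le> \<epsilon> * norm (u w)" if "u w \<noteq> 0" for w
      using mult_strict_right_mono[OF \<epsilon>(2), of "norm (u w)"] that by simp
    then have "B k = {}" unfolding B_def True by auto
    then have "A k = {}" using A_B by blast
    then show ?thesis by simp
  next
    case False
    show ?thesis
    proof (rule Bochner_Integration.integrable_bound)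
      show "integrable M (\<lambda>w. 2 / norm (d k) * norm (u w))" using ui by simp
      have "norm (indicator (A k) w :: real) \<le> norm (2 / norm (d k) * norm (u w))" for w
      proof (cases "w \<in> A k")
        case True
        then have "norm (u w - d k) \<le> \<epsilon> * norm (u w)" using A_B by (auto simp: B_def)
        also have "\<dots> \<le> norm (u w)"
          using \<epsilon> by (intro mult_left_le_one_le) auto
        finally have "norm (d k) \<le> 2 * norm (u w)"
          using norm_triangle_sub[of "d k" "u w"] by (simp add: norm_minus_commute)
        with False True show ?thesis by (simp add: field_simps)
      qed simp
      then show "AE w in M. norm (indicator (A k) w :: real) \<le> norm (2 / norm (d k) * norm (u w))"
        by simp
    qed simp
  qed
  with u' approx has_sum_v show ?thesis
    by (intro exI[of _ A] exI[of _ d] exI[of _ "\<lambda>w. u w - v w"]) simp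
qed

lemma prod_decode_has_sum:
  "((\<lambda>i. f (prod_decode i)) has_sum S) UNIV \<longleftrightarrow> (f has_sum S) (UNIV \<times> UNIV)"
  using has_sum_reindex_bij_betw[of prod_decode UNIV UNIV f S] bij_prod_decode by simp

context banach_over
begin

lemma tensor_of_real_indicator:
  "tensor scl (\<lambda>w. of_real (indicator A w)) d w = indicator A w *\<^sub>R d"
  by (simp add: tensor_def scl_of_real)

text \<open>
  Iterating the countably valued approximation on its remainder: the remainders decay like
  \<open>\<epsilon>^n\<close>, and the values taken at each stage contribute the tensors.
\<close>

lemma ex_tensor_sum_near_norm:
  fixes u :: "'w \<Rightarrow> 'y"
  assumes u: "bochner_integrable M u" and \<epsilon>: "0 < \<epsilon>" "\<epsilon> < 1"
  shows "\<exists>x y t. (\<forall>i. integrable M (x i)) \<and> has_tensor_sum M scl UNIV x y u \<and>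
    ((\<lambda>i. L1_norm M (x i) * norm (y i)) has_sum t) UNIV \<and>
    t \<le> (1 + \<epsilon>) / (1 - \<epsilon>) * L1_norm M u"
proof -
  define approx where "approx v A d v' \<longleftrightarrow>
    (\<forall>k::nat. integrable M (indicator (A k) :: 'w \<Rightarrow> real)) \<and> bochner_integrable M v' \<and>
    (\<forall>w\<in>space M. norm (v' w) \<le> \<epsilon> * norm (v w) \<and>
      ((\<lambda>k. indicator (A k) w *\<^sub>R d k) has_sum (v w - v' w)) UNIV \<and>
      ((\<lambda>k. norm ((indicator (A k) w :: real) *\<^sub>R d k)) has_sum norm (v w - v' w)) UNIV)"
    for v v' :: "'w \<Rightarrow> 'y" and A d
  have "\<exists>A d v'. approx v A d v'" if "bochner_integrable M v" for v
    using countably_valued_approximation[OF that \<epsilon>] unfolding approx_def .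
  then obtain X D N where "\<And>v. bochner_integrable M v \<Longrightarrow> approx v (X v) (D v) (N v)"
    by metis
  note step = this[unfolded approx_def]
  define U where "U n = (N ^^ n) u" for n
  have U_Suc: "U (Suc n) = N (U n)" for n by (simp add: U_def)
  have U: "bochner_integrable M (U n)" for n
    by (induction n) (use u step in \<open>auto simp: U_def\<close>)
  have U_le: "norm (U n w) \<le> \<epsilon> ^ n * norm (u w)" if w: "w \<in> space M" for n w
  proof (induction n)
    case (Suc n)
    have "norm (U (Suc n) w) \<le> \<epsilon> * norm (U n w)"
      using step[OF U[of n]] w by (simp add: U_Suc)
    also have "\<dots> \<le> \<epsilon> * (\<epsilon> ^ n * norm (u w))"
      using Suc \<epsilon>(1) by (intro mult_left_mono) auto
    finally show ?case by simp
  qed (simp add: U_def)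
  define T where "T p w = (indicator (X (U (fst p)) (snd p)) w :: real) *\<^sub>R D (U (fst p)) (snd p)"
    for p w
  define x :: "nat \<Rightarrow> 'w \<Rightarrow> 'k" where
    "x i = (\<lambda>w. of_real (indicator (X (U (fst (prod_decode i))) (snd (prod_decode i))) w))" for i
  define y where "y i = D (U (fst (prod_decode i))) (snd (prod_decode i))" for i
  have tensor_xy: "tensor scl (x i) (y i) w = T (prod_decode i) w" for i w
    unfolding x_def y_def T_def by (rule tensor_of_real_indicator)
  have x: "integrable M (x i)" for i
    unfolding x_def using step[OF U] by (intro integrable_of_real) blast
  define C where "C = (1 + \<epsilon>) / (1 - \<epsilon>)"
  have pointwise: "((\<lambda>i. tensor scl (x i) (y i) w) has_sum u w) UNIV \<and>
      (\<exists>Q \<le> C * norm (u w). ((\<lambda>i. norm (tensor scl (x i) (y i) w)) has_sum Q) UNIV)"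
    if w: "w \<in> space M" for w
  proof -
    define b where "b n = norm (U n w - U (Suc n) w)" for n
    have b_le: "b n \<le> \<epsilon> ^ n * ((1 + \<epsilon>) * norm (u w))" for n
    proof -
      have "b n \<le> norm (U n w) + norm (U (Suc n) w)"
        unfolding b_def by (rule norm_triangle_ineq4)
      also have "\<dots> \<le> \<epsilon> ^ n * norm (u w) + \<epsilon> ^ Suc n * norm (u w)"
        by (intro add_mono U_le w)
      finally show ?thesis by (simp add: algebra_simps)
    qed
    have geom: "(\<lambda>n. \<epsilon> ^ n * ((1 + \<epsilon>) * norm (u w))) sums (C * norm (u w))"
      using sums_mult2[OF geometric_sums[of \<epsilon>], of "(1 + \<epsilon>) * norm (u w)"] \<epsilon>
      by (simp add: C_def)
    have b: "summable b"
      by (rule summable_comparison_test'[OF sums_summable[OF geom], of 0]) (use b_le in \<open>simp add: b_def\<close>)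
    then have b_sum: "(b has_sum suminf b) UNIV"
      by (intro sums_nonneg_imp_has_sum summable_sums) (simp_all add: b_def)
    have b_sum_le: "suminf b \<le> C * norm (u w)"
      using suminf_le[OF b_le b sums_summable[OF geom]] geom by (simp add: sums_iff)
    have inner: "((\<lambda>k. norm (T (n, k) w)) has_sum b n) UNIV" for n
      using step[OF U[of n]] w by (simp add: T_def b_def U_Suc)
    have summable: "(\<lambda>p. norm (T p w)) summable_on UNIV \<times> UNIV"
      by (rule summable_on_SigmaI[OF inner]) (use b_sum in \<open>auto simp: summable_on_def\<close>)
    have norm_sum: "((\<lambda>p. norm (T p w)) has_sum suminf b) (UNIV \<times> UNIV)"
      by (rule has_sum_SigmaI[OF inner b_sum summable])
    have "(\<lambda>n. \<epsilon> ^ n * norm (u w)) \<longlonglongrightarrow> 0 * norm (u w)"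
      using \<epsilon> by (intro tendsto_mult tendsto_const LIMSEQ_power_zero) simp
    then have "(\<lambda>n. U n w) \<longlonglongrightarrow> 0"
      using U_le[OF w] by (intro Lim_null_comparison[of "\<lambda>n. U n w"]) (auto intro: always_eventually)
    then have "(\<lambda>n. U n w - U (Suc n) w) sums (U 0 w - 0)"
      by (rule telescope_sums')
    then have outer: "((\<lambda>n. U n w - U (Suc n) w) has_sum u w) UNIV"
      using b by (intro norm_summable_imp_has_sum) (simp_all add: b_def[abs_def] U_def)
    have "((\<lambda>k. T (n, k) w) has_sum (U n w - U (Suc n) w)) UNIV" for n
      using step[OF U[of n]] w by (simp add: T_def U_Suc)
    then have "((\<lambda>p. T p w) has_sum u w) (UNIV \<times> UNIV)"
      by (rule has_sum_SigmaI[OF _ outer abs_summable_summable[OF summable]])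
    then show ?thesis
      using norm_sum b_sum_le
      unfolding tensor_xy prod_decode_has_sum[of "\<lambda>p. T p w"]
        prod_decode_has_sum[of "\<lambda>p. norm (T p w)"]
      by blast
  qed
  let ?a = "\<lambda>i. L1_norm M (x i) * norm (y i)"
  have bound: "sum ?a F \<le> C * L1_norm M u" if "finite F" for F
  proof -
    have int: "integrable M (\<lambda>w. norm (tensor scl (x i) (y i) w))" for i
      using bochner_integrable_tensor[OF x] by (simp add: bochner_integrable_def)
    have "sum ?a F = (\<Sum>i\<in>F. \<integral>w. norm (tensor scl (x i) (y i) w) \<partial>M)"
      by (simp add: norm_tensor L1_norm_def)
    also have "\<dots> = (\<integral>w. (\<Sum>i\<in>F. norm (tensor scl (x i) (y i) w)) \<partial>M)"
      using int by simp
    also have "\<dots> \<le> (\<integral>w. C * norm (u w) \<partial>M)"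
    proof (rule integral_mono)
      show "integrable M (\<lambda>w. C * norm (u w))"
        using u by (simp add: bochner_integrable_def)
      fix w assume "w \<in> space M"
      then obtain Q where Q: "Q \<le> C * norm (u w)"
        "((\<lambda>i. norm (tensor scl (x i) (y i) w)) has_sum Q) UNIV"
        using pointwise by blast
      have "(\<Sum>i\<in>F. norm (tensor scl (x i) (y i) w)) \<le> Q"
        by (rule finite_sum_le_has_sum[OF Q(2) that]) auto
      with Q(1) show "(\<Sum>i\<in>F. norm (tensor scl (x i) (y i) w)) \<le> C * norm (u w)" by simp
    qed (use int in simp)
    finally show ?thesis by (simp add: L1_norm_def)
  qed
  have "?a summable_on UNIV"
    using bound
    by (intro nonneg_bdd_above_summable_on)
      (auto simp: L1_norm_def intro!: bdd_aboveI[of _ "C * L1_norm M u"])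
  then obtain t where t: "(?a has_sum t) UNIV" by (auto simp: summable_on_def)
  have "t \<le> C * L1_norm M u"
    using t bound by (rule has_sum_le_finite_sums)
  moreover have "has_tensor_sum M scl UNIV x y u"
    by (rule has_tensor_sumI[OF u _ t]) (use x pointwise in \<open>auto intro: AE_I2\<close>)
  ultimately show ?thesis
    using x t unfolding C_def by blast
qed

lemma proj_norm_eq_L1_norm:
  assumes u: "bochner_integrable M u"
  shows "proj_norm M scl u = L1_norm M u"
proof -
  define R where "R = {t. \<exists>x y. (\<forall>i. integrable M (x i)) \<and> has_tensor_sum M scl UNIV x y u \<and>
     ((\<lambda>i. L1_norm M (x i) * norm (y i)) has_sum t) UNIV}"
  have le: "L1_norm M u \<le> t" if "t \<in> R" for t
    using that L1_norm_le_tensor_sum(1)[OF u, of UNIV] unfolding R_def by blast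
  then have bdd: "bdd_below R" by (rule bdd_belowI)
  have near: "\<exists>t\<in>R. t \<le> (1 + \<epsilon>) / (1 - \<epsilon>) * L1_norm M u" if "0 < \<epsilon>" "\<epsilon> < 1" for \<epsilon>
    using ex_tensor_sum_near_norm[OF u that] unfolding R_def by blast
  have "Inf R \<le> (1 + 0) / (1 - 0) * L1_norm M u"
  proof (rule tendsto_lowerbound)
    show "((\<lambda>\<epsilon>. (1 + \<epsilon>) / (1 - \<epsilon>) * L1_norm M u) \<longlongrightarrow> (1 + 0) / (1 - 0) * L1_norm M u) (at_right 0)"
      by (intro tendsto_intros) auto
    show "\<forall>\<^sub>F \<epsilon> in at_right 0. Inf R \<le> (1 + \<epsilon>) / (1 - \<epsilon>) * L1_norm M u"
      unfolding eventually_at_right_field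
      using near cInf_lower[OF _ bdd] by (intro exI[of _ 1]) (auto intro: order_trans)
  qed simp
  moreover have "L1_norm M u \<le> Inf R"
    using near[of "1/2"] le by (intro cInf_greatest) auto
  ultimately show ?thesis by (simp add: proj_norm_def R_def)
qed

end

section \<open>Coordinates along a line\<close>

definition coord :: "('k::real_or_complex \<Rightarrow> 'y::banach \<Rightarrow> 'y) \<Rightarrow> 'y \<Rightarrow> 'y \<Rightarrow> 'k" where
  "coord scl e v = (if v \<in> range (\<lambda>c. scl c e) then inv (\<lambda>c. scl c e) v else 0)"

context banach_over
begin

lemma coord_scl: "e \<noteq> 0 \<Longrightarrow> coord scl e (scl c e) = c"
  using inv_f_f[of "\<lambda>c. scl c e" c] by (simp add: coord_def inj_on_def)

lemma coord_0: "e \<noteq> 0 \<Longrightarrow> coord scl e 0 = 0"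
  using coord_scl[of e 0] by simp

lemma coord_nonzero_in_range: "coord scl e v \<noteq> 0 \<Longrightarrow> v \<in> range (\<lambda>c. scl c e)"
  by (auto simp: coord_def split: if_splits)

lemma coord_in_range:
  "e \<noteq> 0 \<Longrightarrow> v \<in> range (\<lambda>c. scl c e) \<Longrightarrow> scl (coord scl e v) e = v"
  using coord_scl by auto

lemma norm_coord_le: "norm e = 1 \<Longrightarrow> norm (coord scl e v) \<le> norm v"
proof (cases "v \<in> range (\<lambda>c. scl c e)")
  case True
  moreover assume "norm e = 1"
  ultimately show ?thesis
    using coord_in_range[of e v] norm_scl[of "coord scl e v" e] by force
qed (simp add: coord_def)

lemma coord_scl_basis:
  assumes "c \<noteq> 0" and "e \<noteq> 0"
  shows "coord scl (scl c e) v = inverse c * coord scl e v"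
proof (cases "v \<in> range (\<lambda>a. scl a e)")
  case True
  then obtain a where v: "v = scl a e" by blast
  have "v = scl (inverse c * a) (scl c e)"
    using assms(1) by (simp add: v)
  then have "coord scl (scl c e) v = inverse c * a"
    using coord_scl[of "scl c e"] assms by simp
  then show ?thesis by (simp add: v coord_scl assms(2))
next
  case False
  then have "v \<notin> range (\<lambda>a. scl a (scl c e))" by auto
  with False show ?thesis by (simp add: coord_def)
qed

lemma closed_range_scl:
  assumes "norm e = 1"
  shows "closed (range (\<lambda>c. scl c e))"
  by (intro complete_imp_closed complete_isometric_image[of 1 UNIV])
    (auto simp: norm_scl assms bounded_linear_scl_left complete_UNIV)

lemma borel_measurable_coord:
  assumes e: "norm e = 1"
  shows "coord scl e \<in> borel_measurable borel"
proof -
  let ?S = "range (\<lambda>c. scl c e)"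
  have e0: "e \<noteq> 0" using e by auto
  have "dist (coord scl e v) (coord scl e v') = dist v v'" if "v \<in> ?S" "v' \<in> ?S" for v v'
    using that
    by (auto simp: coord_scl e0 dist_norm norm_scl e simp flip: scale_left_diff_distrib)
  then have "continuous_on ?S (coord scl e)"
    unfolding continuous_on_iff by metis
  then have "(\<lambda>v. indicator ?S v *\<^sub>R coord scl e v) \<in> borel_measurable borel"
    by (intro borel_measurable_continuous_on_indicator borel_closed closed_range_scl e)
  also have "(\<lambda>v. indicator ?S v *\<^sub>R coord scl e v) = coord scl e"
    by (auto simp: coord_def indicator_def)
  finally show ?thesis .
qed

lemma colinear_iff:
  assumes "x \<noteq> 0" and "y \<noteq> 0"
  shows "colinear scl x y \<longleftrightarrow> (\<exists>c. c \<noteq> 0 \<and> y = scl c x)"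
proof
  assume "colinear scl x y"
  then obtain a b where ab: "a \<noteq> 0 \<or> b \<noteq> 0" and eq: "scl a x + scl b y = 0"
    unfolding colinear_def by blast
  have "b \<noteq> 0" using ab eq assms by auto
  have "a \<noteq> 0" using ab eq assms by auto
  have "scl b y = scl (- a) x" using eq by (simp add: eq_neg_iff_add_eq_0 add.commute)
  then have "scl (inverse b) (scl b y) = scl (inverse b) (scl (- a) x)" by simp
  then have "y = scl (- (inverse b * a)) x" using \<open>b \<noteq> 0\<close> by simp
  then show "\<exists>c. c \<noteq> 0 \<and> y = scl c x"
    using \<open>a \<noteq> 0\<close> \<open>b \<noteq> 0\<close> by (metis neg_equal_0_iff_equal mult_eq_0_iff inverse_nonzero_iff_nonzero)
next
  assume "\<exists>c. c \<noteq> 0 \<and> y = scl c x"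
  then obtain c where "y = scl c x" by blast
  then have "scl c x + scl (- 1) y = 0" by simp
  then show "colinear scl x y" unfolding colinear_def by (metis neg_equal_0_iff_equal one_neq_zero)
qed

lemma colinear_sym: "colinear scl x y \<Longrightarrow> colinear scl y x"
  unfolding colinear_def by (metis add.commute)

lemma colinear_trans:
  assumes "x \<noteq> 0" "y \<noteq> 0" "z \<noteq> 0" and "colinear scl x y" and "colinear scl y z"
  shows "colinear scl x z"
proof -
  obtain c d where "c \<noteq> 0" "y = scl c x" "d \<noteq> 0" "z = scl d y"
    using assms colinear_iff by meson
  then have "d * c \<noteq> 0" "z = scl (d * c) x" by simp_all
  then show ?thesis using assms colinear_iff by blast
qed

lemma colinear_if_common_multiple:
  assumes "v \<noteq> 0" and "v \<in> range (\<lambda>c. scl c x)" and "v \<in> range (\<lambda>c. scl c y)"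
  shows "colinear scl x y"
proof -
  obtain a b where ab: "v = scl a x" "v = scl b y" using assms by blast
  then have "a \<noteq> 0" using assms(1) by auto
  moreover have "scl a x + scl (- b) y = 0" using ab by simp
  ultimately show ?thesis unfolding colinear_def by blast
qed

lemma range_scl_colinear:
  assumes "x \<noteq> 0" and "y \<noteq> 0" and "colinear scl x y"
  shows "range (\<lambda>c. scl c x) = range (\<lambda>c. scl c y)"
proof -
  have "range (\<lambda>c. scl c y) \<subseteq> range (\<lambda>c. scl c x)"
    if "x \<noteq> 0" "y \<noteq> 0" "colinear scl x y" for x y
    using that by (auto simp: colinear_iff)
  then show ?thesis using assms colinear_sym by blast
qed

lemma scaleR_in_range_scl: "r *\<^sub>R scl a x \<in> range (\<lambda>c. scl c x)"
proof -
  have "r *\<^sub>R scl a x = scl (of_real r * a) x" by (simp add: scl_of_real flip: scale_scale)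
  then show ?thesis by blast
qed

end

section \<open>Representations by pairwise non-colinear vectors\<close>

context banach_over
begin

lemma noncolinear_rep_pointwise:
  assumes sc: "strictly_convex TYPE('y)"
    and z: "\<And>j. j \<in> J \<Longrightarrow> z j \<noteq> 0"
    and nc: "\<And>j k. j \<in> J \<Longrightarrow> k \<in> J \<Longrightarrow> j \<noteq> k \<Longrightarrow> \<not> colinear scl (z j) (z k)"
    and s: "((\<lambda>j. scl (a j) (z j)) has_sum v) J"
    and n: "((\<lambda>j. norm (scl (a j) (z j))) has_sum norm v) J"
  shows "\<And>j. j \<in> J \<Longrightarrow> a j = coord scl (z j) v"
    and "v \<noteq> 0 \<Longrightarrow> \<exists>j\<in>J. v \<in> range (\<lambda>c. scl c (z j))"
proof -
  have ray: "v \<noteq> 0 \<and> v \<in> range (\<lambda>c. scl c (z j))" if j: "j \<in> J" "a j \<noteq> 0" for j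
  proof -
    have "scl (a j) (z j) \<noteq> 0" using j z by simp
    moreover from has_sum_norm_eq_imp_ray[OF sc s n j(1) this]
    obtain r where "r > 0" "v = r *\<^sub>R scl (a j) (z j)" by blast
    ultimately show ?thesis by (simp add: scaleR_in_range_scl)
  qed
  have ex: "\<exists>j\<in>J. a j \<noteq> 0" if "v \<noteq> 0"
  proof (rule ccontr)
    assume "\<not> (\<exists>j\<in>J. a j \<noteq> 0)"
    then have "((\<lambda>j. scl (a j) (z j)) has_sum 0) J" by (intro has_sum_0) auto
    with s that show False by (metis has_sum_unique)
  qed
  then show "\<exists>j\<in>J. v \<in> range (\<lambda>c. scl c (z j))" if "v \<noteq> 0"
    using ray that by blast
  fix j assume j: "j \<in> J"
  show "a j = coord scl (z j) v"
  proof (cases "a j = 0")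
    case True
    have "coord scl (z j) v = 0"
    proof (rule ccontr)
      assume "coord scl (z j) v \<noteq> 0"
      then have v: "v \<in> range (\<lambda>c. scl c (z j))" "v \<noteq> 0"
        using coord_nonzero_in_range coord_0[OF z[OF j]] by auto
      then obtain k where k: "k \<in> J" "a k \<noteq> 0" using ex by blast
      then have "colinear scl (z j) (z k)"
        using colinear_if_common_multiple v ray by blast
      moreover have "j \<noteq> k" using True k(2) by blast
      ultimately show False using nc j k(1) by blast
    qed
    with True show ?thesis by simp
  next
    case False
    have "a k = 0" if "k \<in> J" "k \<noteq> j" for k
      using colinear_if_common_multiple[of v "z j" "z k"] ray[OF j False] ray[OF that(1)]
        nc[OF j that(1)] that(2) by blast
    then have "((\<lambda>j. scl (a j) (z j)) has_sum (scl (a j) (z j))) J"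
      using j by (intro has_sum_finite_neutralI[of "{j}"]) auto
    with s have "v = scl (a j) (z j)" by (rule has_sum_unique)
    then show ?thesis by (simp add: coord_scl z j)
  qed
qed

lemma noncolinear_rep_coord:
  assumes sc: "strictly_convex TYPE('y)" and u: "bochner_integrable M u"
    and rep: "noncolinear_rep M scl u J g z"
  shows "AE w in M. (\<forall>j\<in>J. g j w = coord scl (z j) (u w)) \<and>
    (u w \<noteq> 0 \<longrightarrow> (\<exists>j\<in>J. u w \<in> range (\<lambda>c. scl c (z j))))"
proof -
  have z: "norm (z j) = 1" if "j \<in> J" for j
    using rep that by (simp add: noncolinear_rep_def)
  have nc: "\<not> colinear scl (z j) (z k)" if "j \<in> J" "k \<in> J" "j \<noteq> k" for j k
    using rep that unfolding noncolinear_rep_def by blast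
  have g: "\<forall>j\<in>J. integrable M (g j)" and tens: "has_tensor_sum M scl J g z u"
    and "((\<lambda>j. L1_norm M (g j)) has_sum L1_norm M u) J"
    using rep by (auto simp: noncolinear_rep_def proj_norm_eq_L1_norm[OF u])
  then have t: "((\<lambda>j. L1_norm M (g j) * norm (z j)) has_sum L1_norm M u) J"
    using z by (simp cong: has_sum_cong)
  show ?thesis
    using AE_has_sum_if_has_tensor_sum[OF u g t tens] L1_norm_le_tensor_sum(2)[OF u g t tens refl]
  proof eventually_elim
    case (elim w)
    have z0: "z j \<noteq> 0" if "j \<in> J" for j using z[OF that] by auto
    show ?case
      using noncolinear_rep_pointwise[OF sc z0 nc elim[unfolded tensor_def]] by blast
  qed
qed

lemma noncolinear_rep_match:
  assumes sc: "strictly_convex TYPE('y)" and u: "bochner_integrable M u"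
    and f: "noncolinear_rep M scl u I f y" and g: "noncolinear_rep M scl u J g z"
    and i: "i \<in> I"
  shows "\<exists>j\<in>J. colinear scl (y i) (z j)"
proof (rule ccontr)
  assume none: "\<not> (\<exists>j\<in>J. colinear scl (y i) (z j))"
  have "norm (y i) = 1" using f i by (simp add: noncolinear_rep_def)
  then have y0: "y i \<noteq> 0" by auto
  have "AE w in M. f i w = 0"
    using noncolinear_rep_coord[OF sc u f] noncolinear_rep_coord[OF sc u g]
  proof eventually_elim
    case (elim w)
    have "coord scl (y i) (u w) = 0"
    proof (rule ccontr)
      assume "coord scl (y i) (u w) \<noteq> 0"
      then have "u w \<in> range (\<lambda>c. scl c (y i))" "u w \<noteq> 0"
        using coord_nonzero_in_range coord_0[OF y0] by auto
      then show False using elim(2) none colinear_if_common_multiple by blast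
    qed
    then show ?case using elim(1) i by simp
  qed
  then show False using f i by (simp add: noncolinear_rep_def)
qed

lemma noncolinear_rep_unique:
  assumes sc: "strictly_convex TYPE('y)" and u: "bochner_integrable M u"
    and f: "noncolinear_rep M scl u I f y" and g: "noncolinear_rep M scl u J g z"
  shows "\<exists>\<phi> \<theta>. bij_betw \<phi> I J \<and>
    (\<forall>i\<in>I. norm (\<theta> i) = 1 \<and> z (\<phi> i) = scl (\<theta> i) (y i) \<and>
      (AE w in M. g (\<phi> i) w = inverse (\<theta> i) * f i w))"
proof -
  have y: "norm (y i) = 1" "y i \<noteq> 0" if "i \<in> I" for i
    using f that by (auto simp: noncolinear_rep_def)
  have z: "norm (z j) = 1" "z j \<noteq> 0" if "j \<in> J" for j
    using g that by (auto simp: noncolinear_rep_def)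
  have y_nc: "i = i'" if "i \<in> I" "i' \<in> I" "colinear scl (y i) (y i')" for i i'
    using f that unfolding noncolinear_rep_def by blast
  have z_nc: "j = j'" if "j \<in> J" "j' \<in> J" "colinear scl (z j) (z j')" for j j'
    using g that unfolding noncolinear_rep_def by blast
  obtain \<phi> where \<phi>: "\<And>i. i \<in> I \<Longrightarrow> \<phi> i \<in> J" "\<And>i. i \<in> I \<Longrightarrow> colinear scl (y i) (z (\<phi> i))"
    using noncolinear_rep_match[OF sc u f g] by metis
  then have "\<forall>i\<in>I. \<exists>c. c \<noteq> 0 \<and> z (\<phi> i) = scl c (y i)"
    using colinear_iff y(2) z(2) by blast
  then obtain \<theta> where \<theta>: "\<And>i. i \<in> I \<Longrightarrow> \<theta> i \<noteq> 0" "\<And>i. i \<in> I \<Longrightarrow> z (\<phi> i) = scl (\<theta> i) (y i)"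
    by metis
  have "inj_on \<phi> I"
  proof (rule inj_onI)
    fix i i' assume i: "i \<in> I" "i' \<in> I" and eq: "\<phi> i = \<phi> i'"
    have "colinear scl (y i) (y i')"
      using colinear_trans[OF y(2)[OF i(1)] z(2)[OF \<phi>(1)[OF i(1)]] y(2)[OF i(2)] \<phi>(2)[OF i(1)]]
        colinear_sym[OF \<phi>(2)[OF i(2)]] eq by simp
    with i show "i = i'" by (rule y_nc)
  qed
  moreover have "\<exists>i\<in>I. j = \<phi> i" if j: "j \<in> J" for j
  proof -
    obtain i where i: "i \<in> I" "colinear scl (z j) (y i)"
      using noncolinear_rep_match[OF sc u g f j] by blast
    have "colinear scl (z j) (z (\<phi> i))"
      by (rule colinear_trans[OF z(2)[OF j] y(2)[OF i(1)] z(2)[OF \<phi>(1)[OF i(1)]] i(2) \<phi>(2)[OF i(1)]])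
    then show ?thesis using z_nc[OF j \<phi>(1)[OF i(1)]] i(1) by blast
  qed
  ultimately have "bij_betw \<phi> I J"
    unfolding bij_betw_def using \<phi>(1) by blast
  moreover have "norm (\<theta> i) = 1" if "i \<in> I" for i
    using norm_scl[of "\<theta> i" "y i"] y[OF that] z[OF \<phi>(1)[OF that]] \<theta>(2)[OF that] by simp
  moreover have "AE w in M. g (\<phi> i) w = inverse (\<theta> i) * f i w" if i: "i \<in> I" for i
    using noncolinear_rep_coord[OF sc u f] noncolinear_rep_coord[OF sc u g]
    by eventually_elim
      (simp add: i \<phi>(1) \<theta>(2) coord_scl_basis[OF \<theta>(1)[OF i] y(2)[OF i]])
  ultimately show ?thesis using \<theta>(2) by blast
qed

lemma colinear_scaleR_cancel:
  assumes "colinear scl (r *\<^sub>R x) (s *\<^sub>R y)" and "r \<noteq> 0" and "s \<noteq> 0"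
  shows "colinear scl x y"
proof -
  obtain a b where "a \<noteq> 0 \<or> b \<noteq> 0" "scl a (r *\<^sub>R x) + scl b (s *\<^sub>R y) = 0"
    using assms(1) unfolding colinear_def by blast
  then have "(a * of_real r \<noteq> 0 \<or> b * of_real s \<noteq> 0) \<and>
      scl (a * of_real r) x + scl (b * of_real s) y = 0"
    using assms(2,3) by (simp add: scl_of_real flip: scale_scale)
  then show ?thesis unfolding colinear_def by blast
qed

lemma range_scl_scaleR:
  assumes "r \<noteq> 0"
  shows "range (\<lambda>c. scl c (r *\<^sub>R y)) = range (\<lambda>c. scl c y)"
proof -
  have "scl c (r *\<^sub>R y) = scl (c * of_real r) y" for c
    by (simp add: scl_of_real flip: scale_scale)
  moreover have "scl c y = scl (c * of_real (inverse r)) (r *\<^sub>R y)" for c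
    using assms unfolding scale_scale[symmetric] scl_of_real by simp
  ultimately show ?thesis by (metis (no_types, lifting) image_subsetI rangeI subset_antisym)
qed

lemma ex_noncolinear_rep:
  fixes u :: "'w \<Rightarrow> 'y"
  assumes sc: "strictly_convex TYPE('y)" and "u \<in> NA_proj M scl"
  shows "\<exists>I e. noncolinear_rep M scl u I (\<lambda>i w. coord scl (e i) (u w)) e"
proof -
  have u: "bochner_integrable M u"
    using assms(2) by (simp add: NA_proj_def)
  obtain x y where x: "\<And>i. integrable M (x i)" and tens: "has_tensor_sum M scl UNIV x y u"
    and t: "((\<lambda>i. L1_norm M (x i) * norm (y i)) has_sum L1_norm M u) UNIV"
    using assms(2) by (auto simp: NA_proj_def proj_norm_eq_L1_norm[OF u])
  have x': "\<forall>i\<in>UNIV. integrable M (x i)" using x by simp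
  define P where "P = {i. y i \<noteq> 0 \<and> \<not> (AE w in M. x i w = 0)}"
  define I where "I = {i \<in> P. \<forall>k\<in>P. k < i \<longrightarrow> \<not> colinear scl (y k) (y i)}"
  define e where "e i = y i /\<^sub>R norm (y i)" for i
  have P: "y i \<noteq> 0" if "i \<in> P" for i using that by (simp add: P_def)
  have I_P: "i \<in> P" if "i \<in> I" for i using that by (simp add: I_def)
  have e: "norm (e i) = 1" "e i \<noteq> 0" "range (\<lambda>c. scl c (e i)) = range (\<lambda>c. scl c (y i))"
    if "i \<in> I" for i
    using P[OF I_P[OF that]] by (simp_all add: e_def range_scl_scaleR)
  have rep: "\<exists>i\<in>I. colinear scl (y i) (y j)" if j: "j \<in> P" for j
  proof -
    let ?Q = "\<lambda>i. i \<in> P \<and> colinear scl (y i) (y j)"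
    define i where "i = (LEAST i. ?Q i)"
    have "colinear scl (y j) (y j)"
      unfolding colinear_def by (intro exI[of _ 1] exI[of _ "- 1"]) simp
    then have i: "?Q i" unfolding i_def using j by (intro LeastI[of ?Q j]) simp
    have "\<not> colinear scl (y k) (y i)" if "k \<in> P" "k < i" for k
    proof
      assume "colinear scl (y k) (y i)"
      then have "?Q k" using i j that(1) colinear_trans[of "y k" "y i" "y j"] P by blast
      with that(2) show False unfolding i_def using not_less_Least by blast
    qed
    with i show ?thesis unfolding I_def by blast
  qed
  have y_nc: "\<not> colinear scl (y i) (y k)" if "i \<in> I" "k \<in> I" "i \<noteq> k" for i k
    using that colinear_sym unfolding I_def by (cases "i < k") (auto dest: colinear_sym)
  have e_nc: "\<not> colinear scl (e i) (e k)" if "i \<in> I" "k \<in> I" "i \<noteq> k" for i k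
  proof
    assume "colinear scl (e i) (e k)"
    then have "colinear scl (y i) (y k)"
      unfolding e_def using P[OF I_P[OF that(1)]] P[OF I_P[OF that(2)]]
      by (elim colinear_scaleR_cancel) simp_all
    with y_nc that show False by blast
  qed
  have ray: "AE w in M. (\<forall>j. x j w \<noteq> 0 \<longrightarrow> y j \<noteq> 0 \<longrightarrow>
        u w \<noteq> 0 \<and> u w \<in> range (\<lambda>c. scl c (y j))) \<and>
      (u w \<noteq> 0 \<longrightarrow> (\<exists>j. x j w \<noteq> 0 \<and> y j \<noteq> 0))"
    using AE_has_sum_if_has_tensor_sum[OF u x' t tens] L1_norm_le_tensor_sum(2)[OF u x' t tens refl]
  proof eventually_elim
    case (elim w)
    have "u w \<noteq> 0 \<and> u w \<in> range (\<lambda>c. scl c (y j))" if j: "x j w \<noteq> 0" "y j \<noteq> 0" for j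
    proof -
      have "tensor scl (x j) (y j) w \<noteq> 0" using j by (simp add: tensor_def)
      moreover from has_sum_norm_eq_imp_ray[OF sc elim UNIV_I this]
      obtain r where "r > 0" "u w = r *\<^sub>R tensor scl (x j) (y j) w" by blast
      ultimately show ?thesis by (simp add: tensor_def scaleR_in_range_scl)
    qed
    moreover have "\<exists>j. x j w \<noteq> 0 \<and> y j \<noteq> 0" if "u w \<noteq> 0"
    proof (rule ccontr)
      assume "\<not> (\<exists>j. x j w \<noteq> 0 \<and> y j \<noteq> 0)"
      then have "((\<lambda>j. tensor scl (x j) (y j) w) has_sum 0) UNIV"
        by (intro has_sum_0) (auto simp: tensor_def)
      with elim(1) that show False by (metis has_sum_unique)
    qed
    ultimately show ?case by blast
  qed
  have null: "AE w in M. \<forall>j. y j \<noteq> 0 \<longrightarrow> j \<notin> P \<longrightarrow> x j w = 0"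
    unfolding AE_all_countable
  proof
    fix j
    show "AE w in M. y j \<noteq> 0 \<longrightarrow> j \<notin> P \<longrightarrow> x j w = 0"
    proof (cases "y j \<noteq> 0 \<and> j \<notin> P")
      case True
      then have "AE w in M. x j w = 0" unfolding P_def by blast
      then show ?thesis by eventually_elim simp
    qed auto
  qed
  define f where "f i w = coord scl (e i) (u w)" for i w
  have sum: "AE w in M. ((\<lambda>i. tensor scl (f i) (e i) w) has_sum u w) I \<and>
      ((\<lambda>i. norm (f i w)) has_sum norm (u w)) I"
    using ray null
  proof eventually_elim
    case (elim w)
    show ?case
    proof (cases "u w = 0")
      case True
      have "f i w = 0" if "i \<in> I" for i
        using coord_0[OF e(2)[OF that]] by (simp add: f_def True)
      then show ?thesis
        by (auto simp: True tensor_def intro!: has_sum_0)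
    next
      case False
      then obtain j where j: "x j w \<noteq> 0" "y j \<noteq> 0" using elim(1) by blast
      then have "j \<in> P" using elim(2) by blast
      then obtain i where i: "i \<in> I" "colinear scl (y i) (y j)" using rep by blast
      have "u w \<in> range (\<lambda>c. scl c (y j))" using elim(1) j by blast
      then have uw: "u w \<in> range (\<lambda>c. scl c (e i))"
        using range_scl_colinear[OF P[OF I_P[OF i(1)]] j(2) i(2)] e(3)[OF i(1)] by simp
      have fi: "scl (f i w) (e i) = u w"
        unfolding f_def by (rule coord_in_range[OF e(2)[OF i(1)] uw])
      have fk: "f k w = 0" if "k \<in> I" "k \<noteq> i" for k
      proof (rule ccontr)
        assume "f k w \<noteq> 0"
        then have "u w \<in> range (\<lambda>c. scl c (e k))"
          unfolding f_def by (rule coord_nonzero_in_range)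
        then have "colinear scl (e k) (e i)"
          using colinear_if_common_multiple[OF False _ uw] by blast
        then show False using e_nc[OF that(1) i(1) that(2)] by blast
      qed
      have "norm (f i w) = norm (u w)"
        using norm_scl[of "f i w" "e i"] fi e(1)[OF i(1)] by simp
      then show ?thesis
        using i(1) fk fi
        by (intro conjI; intro has_sum_finite_neutralI[of "{i}"]) (auto simp: tensor_def)
    qed
  qed
  have ui: "integrable M (\<lambda>w. norm (u w))" and um: "u \<in> borel_measurable M"
    using u strongly_measurable_borel by (auto simp: bochner_integrable_def)
  have f: "integrable M (f i)" if "i \<in> I" for i
  proof (rule Bochner_Integration.integrable_bound[OF ui])
    show "f i \<in> borel_measurable M"
      unfolding f_def[abs_def] by (rule measurable_compose[OF um borel_measurable_coord[OF e(1)[OF that]]])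
    show "AE w in M. norm (f i w) \<le> norm (norm (u w))"
      unfolding f_def using norm_coord_le[OF e(1)[OF that]] by simp
  qed
  have nsum: "((\<lambda>i. L1_norm M (f i)) has_sum L1_norm M u) I"
    unfolding L1_norm_def
    by (rule has_sum_integral) (use f ui sum in auto)
  then have "((\<lambda>i. L1_norm M (f i) * norm (e i)) has_sum L1_norm M u) I"
    using e(1) by (simp cong: has_sum_cong)
  then have "has_tensor_sum M scl I f e u"
    using f sum by (intro has_tensor_sumI[OF u]) auto
  moreover have "\<not> (AE w in M. f i w = 0)" if i: "i \<in> I" for i
  proof
    assume "AE w in M. f i w = 0"
    with ray have "AE w in M. x i w = 0"
    proof eventually_elim
      case (elim w)
      show ?case
      proof (rule ccontr)
        assume "x i w \<noteq> 0"
        then have "u w \<noteq> 0" "u w \<in> range (\<lambda>c. scl c (e i))"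
          using elim(1) P[OF I_P[OF i]] e(3)[OF i] by blast+
        then show False
          using coord_in_range[OF e(2)[OF i]] elim(2) unfolding f_def by force
      qed
    qed
    then show False using I_P[OF i] by (simp add: P_def)
  qed
  ultimately have "noncolinear_rep M scl u I f e"
    using e(1) e_nc f nsum by (simp add: noncolinear_rep_def proj_norm_eq_L1_norm[OF u])
  then show ?thesis unfolding f_def[abs_def] by blast
qed

lemma coord_eq_functional:
  assumes "norm e = 1" and "\<And>c v. h (scl c v) = c * h v" and "h e = 1"
    and "u w \<in> range (\<lambda>c. scl c e) \<longleftrightarrow> w \<in> E"
  shows "coord scl e (u w) = h (u w) * indicator E w"
proof (cases "w \<in> E")
  case True
  then obtain c where "u w = scl c e" using assms(4) by blast
  moreover have "e \<noteq> 0" using assms(1) by auto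
  ultimately show ?thesis using True assms(2,3) by (simp add: coord_scl)
next
  case False
  with assms(4) show ?thesis by (simp add: coord_def)
qed

end

theorem corollary3p3:
  fixes M :: "'a measure"
    and scl :: "'k::real_or_complex \<Rightarrow> 'y::banach \<Rightarrow> 'y"
    and u :: "'a \<Rightarrow> 'y"
  assumes "banach_over scl"
    and "strictly_convex TYPE('y)"
    and "u \<in> NA_proj M scl"
  shows "\<exists>(I :: nat set) (f :: nat \<Rightarrow> 'a \<Rightarrow> 'k) (y :: nat \<Rightarrow> 'y).
    noncolinear_rep M scl u I f y \<and>
    (\<forall>i\<in>I. let E = {w \<in> space M. u w \<in> module.span scl {y i}} in
       E \<in> sets M \<and>
       (\<forall>ystar \<in> dual_sphere scl. ystar (y i) = 1 \<longrightarrow>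
          (AE w in M. f i w = ystar (u w) * indicator E w))) \<and>
    (\<forall>(J :: nat set) (g :: nat \<Rightarrow> 'a \<Rightarrow> 'k) (z :: nat \<Rightarrow> 'y).
       noncolinear_rep M scl u J g z \<longrightarrow>
       (\<exists>(\<phi> :: nat \<Rightarrow> nat) (\<theta> :: nat \<Rightarrow> 'k). bij_betw \<phi> I J \<and>
          (\<forall>i\<in>I. norm (\<theta> i) = 1 \<and> z (\<phi> i) = scl (\<theta> i) (y i) \<and>
             (AE w in M. g (\<phi> i) w = inverse (\<theta> i) * f i w))))"
proof -
  interpret banach_over scl by fact
  have u: "bochner_integrable M u"
    using assms(3) by (simp add: NA_proj_def)
  then have um: "u \<in> borel_measurable M"
    using strongly_measurable_borel by (auto simp: bochner_integrable_def)
  obtain I y where rep: "noncolinear_rep M scl u I (\<lambda>i w. coord scl (y i) (u w)) y"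
    using ex_noncolinear_rep[OF assms(2,3)] by blast
  have formula: "let E = {w \<in> space M. u w \<in> span {y i}} in
       E \<in> sets M \<and>
       (\<forall>ystar \<in> dual_sphere scl. ystar (y i) = 1 \<longrightarrow>
          (AE w in M. coord scl (y i) (u w) = ystar (u w) * indicator E w))" if i: "i \<in> I" for i
  proof -
    have y: "norm (y i) = 1" using rep i by (simp add: noncolinear_rep_def)
    let ?E = "{w \<in> space M. u w \<in> range (\<lambda>c. scl c (y i))}"
    have "u -` range (\<lambda>c. scl c (y i)) \<inter> space M \<in> sets M"
      by (rule measurable_sets[OF um borel_closed[OF closed_range_scl[OF y]]])
    also have "u -` range (\<lambda>c. scl c (y i)) \<inter> space M = ?E" by blast
    finally have "?E \<in> sets M" .
    moreover have "AE w in M. coord scl (y i) (u w) = ystar (u w) * indicator ?E w"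
      if "ystar \<in> dual_sphere scl" "ystar (y i) = 1" for ystar
      using that by (intro AE_I2 coord_eq_functional[OF y]) (auto simp: dual_sphere_def)
    ultimately show ?thesis unfolding span_singleton Let_def by blast
  qed
  show ?thesis
    using rep formula noncolinear_rep_unique[OF assms(2) u rep]
    by (intro exI[of _ I] exI[of _ "\<lambda>i w. coord scl (y i) (u w)"] exI[of _ y]) blast
qed

end
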